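(* Let $i\colon A\to B$ and $\alpha\colon X\to Y$ be maps in $\mathcal M$, and let $f\colon B\to Y$, $H\colon \mathrm{Cyl}(A)\to Y$, $h\colon A\to X$ be maps with $H\circ i_0=f\circ i$ and $H\circ i_1=\alpha\circ h$. Let $L$ be the set of maps $\hat h\colon B\to F(\alpha)$ with $\hat h\circ i=c(\alpha)\circ h$. (1) Each $\hat h\in L$ defines a map $\chi_{\hat h}\colon N(i)\to M(\alpha,\alpha)$, namely the map induced by the universal property of the pushout whose restriction to $\mathrm{Cyl}(A)$ is $j'\circ H$, whose restriction to the copy of $B$ glued along $i_0$ is $j'\circ f$, and whose restriction to the copy of $B$ glued along $i_1$ is $j\circ\hat h$. (2) For each pair $(K,g)\in \mathrm{Sol}(i,\alpha;f,H,h)$ there is an $\hat h\in L$ such that $\chi_{\hat h}$ extends over the cylinder on $B$, i.e. there is a map $\mathcal X\colon \mathrm{Cyl}(B)\to M(\alpha,\alpha)$ with $\mathcal X\circ\iota=\chi_{\hat h}$. (3) Assume that $i_{1,A}\colon A\to \mathrm{Cyl}(A)$ has the left lifting property with respect to $f(j)\colon C(j)\to M(\alpha,\alpha)$ and that $\iota_1\colon N_1(i)\to \mathrm{Cyl}(B)$ has the left lifting property with respect to $f(j)$. If there is an $\hat h\in L$ such that $\chi_{\hat h}$ extends to a map $\mathcal X\colon\mathrm{Cyl}(B)\to M(\alpha,\alpha)$ with $\mathcal X\circ\iota=\chi_{\hat h}$ and such that $\mathrm{Sol}(i,\lceil\alpha,\alpha\rceil;\Phi_{\ell(\hat h)},\Psi_{\ell(\hat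 h)},h)$ is nonempty, then $\mathrm{Sol}(i,\alpha;f,H,h)$ is nonempty.
   Context: $\mathcal M$ is a model category with functorial good cylinders: for each object $B$ the fold map factors, functorially in $B$, as $B\amalg B\xrightarrow{i_0\amalg i_1}\mathrm{Cyl}(B)\xrightarrow{\pi}B$ with $i_0\amalg i_1$ a cofibration and $\pi$ a weak equivalence. Write $i_{0,B},i_{1,B}$ to specify the domain. Cylinders on $i\colon A\to B$. $N_k(i)$ ($k=0,1$) is the pushout of $\mathrm{Cyl}(A)\xleftarrow{i_k}A\xrightarrow{i}B$, and $\iota_k\colon N_k(i)\to\mathrm{Cyl}(B)$ is induced by $\mathrm{Cyl}(i)$ and $i_{k,B}$. $N(i)$ is the pushout of $\mathrm{Cyl}(A)\xleftarrow{i_0\amalg i_1}A\amalg A\xrightarrow{i\amalg i}B\amalg B$, and $\iota\colon N(i)\to \mathrm{Cyl}(B)$ is induced by $\mathrm{Cyl}(i)$, $i_{0,B}$, $i_{1,B}$. Constructions on $\alpha\colon X\to Y$. Fix a factorization $X\xrightarrow{c(\alpha)}F(\alpha)\xrightarrow{\tilde f(\alpha)}Y$ of $\alpha$ as a cofibration followed by an acyclic fibration. $M(\alpha,\alpha)$ is the pushout of $Y\xleftarrow{\alpha}X\xrightarrow{c(\alpha)}F(\alpha)$, with structure maps $j\colon F(\alpha)\to M(\alpha,\alpha)$ and $j'\colon Y\to M(\alpha,\alpha)$. Fix a factorization $F(\alpha)\xrightarrow{\tilde c(j)}C(j)\xrightarrow{f(j)}M(\alpha,\alpha)$ of $j$ as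 an acyclic cofibration followed by a fibration. $P(\alpha,\alpha)$ is the pullback of $Y\xrightarrow{j'}M(\alpha,\alpha)\xleftarrow{f(j)}C(j)$, with projections $k\colon P(\alpha,\alpha)\to C(j)$ and $k'\colon P(\alpha,\alpha)\to Y$. The cartesian gap map $\lceil\alpha,\alpha\rceil\colon X\to P(\alpha,\alpha)$ is the unique map with $k\circ\lceil\alpha,\alpha\rceil=\tilde c(j)\circ c(\alpha)$ and $k'\circ\lceil\alpha,\alpha\rceil=\alpha$. Solution sets. For maps $i\colon A\to B$, $\theta\colon X\to Z$ and $f\colon B\to Z$, $H\colon\mathrm{Cyl}(A)\to Z$, $h\colon A\to X$ with $H i_0=f i$ and $H i_1=\theta h$, $\mathrm{Sol}(i,\theta;f,H,h)$ denotes the set of pairs $(K\colon \mathrm{Cyl}(B)\to Z,\ g\colon B\to X)$ with $K i_0=f$, $K\circ\mathrm{Cyl}(i)=H$, $K i_1=\theta g$, $g i=h$. The maps $\Phi_{\ell(\hat h)},\Psi_{\ell(\hat h)}$ of (3). Under the lifting assumptions of (3), for $\hat h\in L$ with an extension $\mathcal X$ of $\chi_{\hat h}$, choose $\lambda_0\colon\mathrm{Cyl}(A)\to C(j)$ with $\lambda_0 i_1=\tilde c(j)c(\alpha)h$ and $f(j)\lambda_0=j'H$; let $\mu\colon N_1(i)\to C(j)$ be induced by $\lambda_0$ on $\mathrm{Cyl}(A)$ and $\tilde c(j)\hat h$ on $B$; choose $\nu\colon\mathrm{Cyl}(B)\to C(j)$ with $\nu\iota_1=\mu$ and $f(j)\nu=\mathcal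 X$. Then $\ell(\hat h)\colon N_0(i)\to C(j)$ is the map given by $\lambda_0$ on $\mathrm{Cyl}(A)$ and $\nu i_0$ on $B$; $\Phi_{\ell(\hat h)}\colon B\to P(\alpha,\alpha)$ is the map with $k'\Phi_{\ell(\hat h)}=f$, $k\Phi_{\ell(\hat h)}=\nu i_0$; and $\Psi_{\ell(\hat h)}\colon\mathrm{Cyl}(A)\to P(\alpha,\alpha)$ is the map with $k'\Psi_{\ell(\hat h)}=H$, $k\Psi_{\ell(\hat h)}=\lambda_0$. (These satisfy $\Psi_{\ell(\hat h)}i_0=\Phi_{\ell(\hat h)}i$ and $\Psi_{\ell(\hat h)}i_1=\lceil\alpha,\alpha\rceil h$.) These choices are fixed. *)

theory Defs
  imports Main
begin

section \<open>Categories\<close>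

record ('o, 'm) category =
  Obj :: "'o set"
  Arr :: "'m set"
  Dom :: "'m \<Rightarrow> 'o"
  Cod :: "'m \<Rightarrow> 'o"
  Id :: "'o \<Rightarrow> 'm"
  Comp :: "'m \<Rightarrow> 'm \<Rightarrow> 'm"  (infixl "\<cdot>\<index>" 70)

definition hom :: "('o, 'm, 'r) category_scheme \<Rightarrow> 'o \<Rightarrow> 'o \<Rightarrow> 'm set" where
  "hom C A B = {f \<in> Arr C. Dom C f = A \<and> Cod C f = B}"

locale category =
  fixes C :: "('o, 'm, 'r) category_scheme" (structure)
  assumes dom_closed: "f \<in> Arr C \<Longrightarrow> Dom C f \<in> Obj C"
    and cod_closed: "f \<in> Arr C \<Longrightarrow> Cod C f \<in> Obj C"
    and id_closed: "A \<in> Obj C \<Longrightarrow> Id C A \<in> hom C A A"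
    and comp_closed: "\<lbrakk>f \<in> hom C A B; g \<in> hom C B D\<rbrakk> \<Longrightarrow> g \<cdot> f \<in> hom C A D"
    and id_left: "f \<in> hom C A B \<Longrightarrow> Id C B \<cdot> f = f"
    and id_right: "f \<in> hom C A B \<Longrightarrow> f \<cdot> Id C A = f"
    and comp_assoc: "\<lbrakk>f \<in> hom C A B; g \<in> hom C B D; k \<in> hom C D E\<rbrakk>
      \<Longrightarrow> (k \<cdot> g) \<cdot> f = k \<cdot> (g \<cdot> f)"

definition is_functor ::
  "('a, 'b, 'r) category_scheme \<Rightarrow> ('o, 'm, 's) category_scheme \<Rightarrow> ('a \<Rightarrow> 'o) \<Rightarrow> ('b \<Rightarrow> 'm) \<Rightarrow> bool"
  where
  "is_functor J C Fo Fm \<longleftrightarrow>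
     (\<forall>a \<in> Obj J. Fo a \<in> Obj C) \<and>
     (\<forall>u \<in> Arr J. Fm u \<in> hom C (Fo (Dom J u)) (Fo (Cod J u))) \<and>
     (\<forall>a \<in> Obj J. Fm (Id J a) = Id C (Fo a)) \<and>
     (\<forall>a b d. \<forall>u \<in> hom J a b. \<forall>v \<in> hom J b d. Fm (v \<cdot>\<^bsub>J\<^esub> u) = Fm v \<cdot>\<^bsub>C\<^esub> Fm u)"

definition is_cone ::
  "('a, 'b, 'r) category_scheme \<Rightarrow> ('o, 'm, 's) category_scheme \<Rightarrow> ('a \<Rightarrow> 'o) \<Rightarrow> ('b \<Rightarrow> 'm)
     \<Rightarrow> 'o \<Rightarrow> ('a \<Rightarrow> 'm) \<Rightarrow> bool" where
  "is_cone J C Fo Fm V \<psi> \<longleftrightarrow>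
     V \<in> Obj C \<and> (\<forall>a \<in> Obj J. \<psi> a \<in> hom C V (Fo a)) \<and>
     (\<forall>u \<in> Arr J. Fm u \<cdot>\<^bsub>C\<^esub> \<psi> (Dom J u) = \<psi> (Cod J u))"

definition is_limit ::
  "('a, 'b, 'r) category_scheme \<Rightarrow> ('o, 'm, 's) category_scheme \<Rightarrow> ('a \<Rightarrow> 'o) \<Rightarrow> ('b \<Rightarrow> 'm)
     \<Rightarrow> 'o \<Rightarrow> ('a \<Rightarrow> 'm) \<Rightarrow> bool" where
  "is_limit J C Fo Fm V \<psi> \<longleftrightarrow>
     is_cone J C Fo Fm V \<psi> \<and>
     (\<forall>V' \<psi>'. is_cone J C Fo Fm V' \<psi>' \<longrightarrow>
        (\<exists>!m. m \<in> hom C V' V \<and> (\<forall>a \<in> Obj J. \<psi> a \<cdot>\<^bsub>C\<^esub> m = \<psi>' a)))"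

definition is_cocone ::
  "('a, 'b, 'r) category_scheme \<Rightarrow> ('o, 'm, 's) category_scheme \<Rightarrow> ('a \<Rightarrow> 'o) \<Rightarrow> ('b \<Rightarrow> 'm)
     \<Rightarrow> 'o \<Rightarrow> ('a \<Rightarrow> 'm) \<Rightarrow> bool" where
  "is_cocone J C Fo Fm V \<psi> \<longleftrightarrow>
     V \<in> Obj C \<and> (\<forall>a \<in> Obj J. \<psi> a \<in> hom C (Fo a) V) \<and>
     (\<forall>u \<in> Arr J. \<psi> (Cod J u) \<cdot>\<^bsub>C\<^esub> Fm u = \<psi> (Dom J u))"

definition is_colimit ::
  "('a, 'b, 'r) category_scheme \<Rightarrow> ('o, 'm, 's) category_scheme \<Rightarrow> ('a \<Rightarrow> 'o) \<Rightarrow> ('b \<Rightarrow> 'm)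
     \<Rightarrow> 'o \<Rightarrow> ('a \<Rightarrow> 'm) \<Rightarrow> bool" where
  "is_colimit J C Fo Fm V \<psi> \<longleftrightarrow>
     is_cocone J C Fo Fm V \<psi> \<and>
     (\<forall>V' \<psi>'. is_cocone J C Fo Fm V' \<psi>' \<longrightarrow>
        (\<exists>!m. m \<in> hom C V V' \<and> (\<forall>a \<in> Obj J. m \<cdot>\<^bsub>C\<^esub> \<psi> a = \<psi>' a)))"

text \<open>Every finite category is isomorphic to one whose objects and arrows are natural numbers.\<close>

definition finite_category :: "(nat, nat) category \<Rightarrow> bool" where
  "finite_category J \<longleftrightarrow> category J \<and> finite (Obj J) \<and> finite (Arr J)"

definition has_finite_limits :: "('o, 'm, 'r) category_scheme \<Rightarrow> bool" where
  "has_finite_limits C \<longleftrightarrow>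
     (\<forall>J Fo Fm. finite_category J \<and> is_functor J C Fo Fm \<longrightarrow> (\<exists>V \<psi>. is_limit J C Fo Fm V \<psi>))"

definition has_finite_colimits :: "('o, 'm, 'r) category_scheme \<Rightarrow> bool" where
  "has_finite_colimits C \<longleftrightarrow>
     (\<forall>J Fo Fm. finite_category J \<and> is_functor J C Fo Fm \<longrightarrow> (\<exists>V \<psi>. is_colimit J C Fo Fm V \<psi>))"


section \<open>Coproducts, pushouts and pullbacks\<close>

definition is_coproduct ::
  "('o, 'm, 'r) category_scheme \<Rightarrow> 'o \<Rightarrow> 'o \<Rightarrow> 'o \<Rightarrow> 'm \<Rightarrow> 'm \<Rightarrow> bool" where
  "is_coproduct C A B Q p q \<longleftrightarrow>
     A \<in> Obj C \<and> B \<in> Obj C \<and> p \<in> hom C A Q \<and> q \<in> hom C B Q \<and>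
     (\<forall>V. \<forall>u \<in> hom C A V. \<forall>v \<in> hom C B V.
        \<exists>!w. w \<in> hom C Q V \<and> w \<cdot>\<^bsub>C\<^esub> p = u \<and> w \<cdot>\<^bsub>C\<^esub> q = v)"

text \<open>\<open>is_pushout C f g Q p q\<close>: the square \<open>p \<cdot> f = q \<cdot> g\<close> with apex \<open>Q\<close> is a pushout of the
  span with legs \<open>f\<close> and \<open>g\<close>.\<close>

definition is_pushout ::
  "('o, 'm, 'r) category_scheme \<Rightarrow> 'm \<Rightarrow> 'm \<Rightarrow> 'o \<Rightarrow> 'm \<Rightarrow> 'm \<Rightarrow> bool" where
  "is_pushout C f g Q p q \<longleftrightarrow>
     f \<in> Arr C \<and> g \<in> Arr C \<and> Dom C f = Dom C g \<and>
     p \<in> hom C (Cod C f) Q \<and> q \<in> hom C (Cod C g) Q \<and> p \<cdot>\<^bsub>C\<^esub> f = q \<cdot>\<^bsub>C\<^esub> g \<and>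
     (\<forall>V. \<forall>u \<in> hom C (Cod C f) V. \<forall>v \<in> hom C (Cod C g) V. u \<cdot>\<^bsub>C\<^esub> f = v \<cdot>\<^bsub>C\<^esub> g \<longrightarrow>
        (\<exists>!w. w \<in> hom C Q V \<and> w \<cdot>\<^bsub>C\<^esub> p = u \<and> w \<cdot>\<^bsub>C\<^esub> q = v))"

text \<open>\<open>is_pullback C f g Q p q\<close>: the square \<open>f \<cdot> p = g \<cdot> q\<close> with apex \<open>Q\<close> is a pullback of the
  cospan with legs \<open>f\<close> and \<open>g\<close>.\<close>

definition is_pullback ::
  "('o, 'm, 'r) category_scheme \<Rightarrow> 'm \<Rightarrow> 'm \<Rightarrow> 'o \<Rightarrow> 'm \<Rightarrow> 'm \<Rightarrow> bool" where
  "is_pullback C f g Q p q \<longleftrightarrow>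
     f \<in> Arr C \<and> g \<in> Arr C \<and> Cod C f = Cod C g \<and>
     p \<in> hom C Q (Dom C f) \<and> q \<in> hom C Q (Dom C g) \<and> f \<cdot>\<^bsub>C\<^esub> p = g \<cdot>\<^bsub>C\<^esub> q \<and>
     (\<forall>V. \<forall>u \<in> hom C V (Dom C f). \<forall>v \<in> hom C V (Dom C g). f \<cdot>\<^bsub>C\<^esub> u = g \<cdot>\<^bsub>C\<^esub> v \<longrightarrow>
        (\<exists>!w. w \<in> hom C V Q \<and> p \<cdot>\<^bsub>C\<^esub> w = u \<and> q \<cdot>\<^bsub>C\<^esub> w = v))"

text \<open>The map induced by \<open>u\<close> and \<open>v\<close> out of the coproduct or pushout with structure maps
  \<open>p\<close> and \<open>q\<close>, respectively into the pullback with projections \<open>p\<close> and \<open>q\<close>.\<close>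

definition copair :: "('o, 'm, 'r) category_scheme \<Rightarrow> 'm \<Rightarrow> 'm \<Rightarrow> 'm \<Rightarrow> 'm \<Rightarrow> 'm" where
  "copair C p q u v =
     (THE w. w \<in> hom C (Cod C p) (Cod C u) \<and> w \<cdot>\<^bsub>C\<^esub> p = u \<and> w \<cdot>\<^bsub>C\<^esub> q = v)"

definition pair :: "('o, 'm, 'r) category_scheme \<Rightarrow> 'm \<Rightarrow> 'm \<Rightarrow> 'm \<Rightarrow> 'm \<Rightarrow> 'm" where
  "pair C p q u v =
     (THE w. w \<in> hom C (Dom C u) (Dom C p) \<and> p \<cdot>\<^bsub>C\<^esub> w = u \<and> q \<cdot>\<^bsub>C\<^esub> w = v)"


section \<open>Model categories\<close>

text \<open>\<open>left_lifting C i p\<close>: \<open>i\<close> has the left lifting property with respect to \<open>p\<close>.\<close>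

definition left_lifting :: "('o, 'm, 'r) category_scheme \<Rightarrow> 'm \<Rightarrow> 'm \<Rightarrow> bool" where
  "left_lifting C i p \<longleftrightarrow>
     (\<forall>u \<in> hom C (Dom C i) (Dom C p). \<forall>v \<in> hom C (Cod C i) (Cod C p).
        p \<cdot>\<^bsub>C\<^esub> u = v \<cdot>\<^bsub>C\<^esub> i \<longrightarrow>
        (\<exists>w \<in> hom C (Cod C i) (Dom C p). w \<cdot>\<^bsub>C\<^esub> i = u \<and> p \<cdot>\<^bsub>C\<^esub> w = v))"

definition is_retract :: "('o, 'm, 'r) category_scheme \<Rightarrow> 'm \<Rightarrow> 'm \<Rightarrow> bool" where
  "is_retract C f g \<longleftrightarrow>
     f \<in> Arr C \<and> g \<in> Arr C \<and>
     (\<exists>s \<in> hom C (Dom C f) (Dom C g). \<exists>r \<in> hom C (Dom C g) (Dom C f).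
      \<exists>s' \<in> hom C (Cod C f) (Cod C g). \<exists>r' \<in> hom C (Cod C g) (Cod C f).
        r \<cdot>\<^bsub>C\<^esub> s = Id C (Dom C f) \<and> r' \<cdot>\<^bsub>C\<^esub> s' = Id C (Cod C f) \<and>
        g \<cdot>\<^bsub>C\<^esub> s = s' \<cdot>\<^bsub>C\<^esub> f \<and> f \<cdot>\<^bsub>C\<^esub> r = r' \<cdot>\<^bsub>C\<^esub> g)"

record ('o, 'm) model_cat = "('o, 'm) category" +
  Weq :: "'m set"
  Cof :: "'m set"
  Fib :: "'m set"

definition wide_subcategory :: "('o, 'm, 'r) category_scheme \<Rightarrow> 'm set \<Rightarrow> bool" where
  "wide_subcategory C S \<longleftrightarrow>
     S \<subseteq> Arr C \<and> (\<forall>A \<in> Obj C. Id C A \<in> S) \<and>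
     (\<forall>f \<in> S. \<forall>g \<in> S. Dom C g = Cod C f \<longrightarrow> g \<cdot>\<^bsub>C\<^esub> f \<in> S)"

text \<open>The axioms are those of Quillen's closed model categories in the form of Dwyer and
  Spalinski: only finite limits and colimits are required, and the factorizations are not
  required to be functorial.\<close>

locale model_category = category M
  for M :: "('o, 'm, 'r) model_cat_scheme" (structure) +
  assumes finite_limits: "has_finite_limits M"
    and finite_colimits: "has_finite_colimits M"
    and subcategories: "wide_subcategory M (Weq M)" "wide_subcategory M (Cof M)"
      "wide_subcategory M (Fib M)"
    and two_of_three:
      "\<lbrakk>f \<in> hom M A B; g \<in> hom M B D; f \<in> Weq M; g \<cdot> f \<in> Weq M\<rbrakk> \<Longrightarrow> g \<in> Weq M"
      "\<lbrakk>f \<in> hom M A B; g \<in> hom M B D; g \<in> Weq M; g \<cdot> f \<in> Weq M\<rbrakk> \<Longrightarrow> f \<in> Weq M"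
    and retracts: "\<lbrakk>is_retract M f g; g \<in> Weq M\<rbrakk> \<Longrightarrow> f \<in> Weq M"
      "\<lbrakk>is_retract M f g; g \<in> Cof M\<rbrakk> \<Longrightarrow> f \<in> Cof M"
      "\<lbrakk>is_retract M f g; g \<in> Fib M\<rbrakk> \<Longrightarrow> f \<in> Fib M"
    and lifting: "\<lbrakk>i \<in> Cof M; p \<in> Fib M \<inter> Weq M\<rbrakk> \<Longrightarrow> left_lifting M i p"
      "\<lbrakk>i \<in> Cof M \<inter> Weq M; p \<in> Fib M\<rbrakk> \<Longrightarrow> left_lifting M i p"
    and factorization:
      "f \<in> hom M A B \<Longrightarrow>
         \<exists>D. \<exists>c \<in> hom M A D \<inter> Cof M. \<exists>p \<in> hom M D B \<inter> Fib M \<inter> Weq M. p \<cdot> c = f"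
      "f \<in> hom M A B \<Longrightarrow>
         \<exists>D. \<exists>c \<in> hom M A D \<inter> Cof M \<inter> Weq M. \<exists>p \<in> hom M D B \<inter> Fib M. p \<cdot> c = f"


section \<open>Functorial good cylinders\<close>

text \<open>\<open>Dbl B\<close> with \<open>In0 B\<close>, \<open>In1 B\<close> is a fixed coproduct of \<open>B\<close> with itself; \<open>End0 B\<close> and
  \<open>End1 B\<close> are the inclusions \<open>i\<^sub>0, i\<^sub>1\<close> of \<open>B\<close> into \<open>Cyl B\<close>.\<close>

record ('o, 'm) cylinders =
  Dbl :: "'o \<Rightarrow> 'o"
  In0 :: "'o \<Rightarrow> 'm"
  In1 :: "'o \<Rightarrow> 'm"
  Cyl :: "'o \<Rightarrow> 'o"
  CylMap :: "'m \<Rightarrow> 'm"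
  End0 :: "'o \<Rightarrow> 'm"
  End1 :: "'o \<Rightarrow> 'm"
  Proj :: "'o \<Rightarrow> 'm"

definition Ends :: "('o, 'm, 'r) category_scheme \<Rightarrow> ('o, 'm) cylinders \<Rightarrow> 'o \<Rightarrow> 'm" where
  "Ends M Z B = copair M (In0 Z B) (In1 Z B) (End0 Z B) (End1 Z B)"

definition fold_map :: "('o, 'm, 'r) category_scheme \<Rightarrow> ('o, 'm) cylinders \<Rightarrow> 'o \<Rightarrow> 'm" where
  "fold_map M Z B = copair M (In0 Z B) (In1 Z B) (Id M B) (Id M B)"

definition dbl_map :: "('o, 'm, 'r) category_scheme \<Rightarrow> ('o, 'm) cylinders \<Rightarrow> 'm \<Rightarrow> 'm" where
  "dbl_map M Z i = copair M (In0 Z (Dom M i)) (In1 Z (Dom M i))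
     (In0 Z (Cod M i) \<cdot>\<^bsub>M\<^esub> i) (In1 Z (Cod M i) \<cdot>\<^bsub>M\<^esub> i)"

definition functorial_good_cylinders ::
  "('o, 'm, 'r) model_cat_scheme \<Rightarrow> ('o, 'm) cylinders \<Rightarrow> bool" where
  "functorial_good_cylinders M Z \<longleftrightarrow>
     is_functor M M (Cyl Z) (CylMap Z) \<and>
     (\<forall>B \<in> Obj M.
        is_coproduct M B B (Dbl Z B) (In0 Z B) (In1 Z B) \<and>
        End0 Z B \<in> hom M B (Cyl Z B) \<and> End1 Z B \<in> hom M B (Cyl Z B) \<and>
        Proj Z B \<in> hom M (Cyl Z B) B \<and>
        Proj Z B \<cdot>\<^bsub>M\<^esub> Ends M Z B = fold_map M Z B \<and>
        Ends M Z B \<in> Cof M \<and> Proj Z B \<in> Weq M) \<and>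
     (\<forall>f \<in> Arr M.
        CylMap Z f \<cdot>\<^bsub>M\<^esub> End0 Z (Dom M f) = End0 Z (Cod M f) \<cdot>\<^bsub>M\<^esub> f \<and>
        CylMap Z f \<cdot>\<^bsub>M\<^esub> End1 Z (Dom M f) = End1 Z (Cod M f) \<cdot>\<^bsub>M\<^esub> f \<and>
        Proj Z (Cod M f) \<cdot>\<^bsub>M\<^esub> CylMap Z f = f \<cdot>\<^bsub>M\<^esub> Proj Z (Dom M f))"


section \<open>Cylinders on a map\<close>

text \<open>Chosen pushouts \<open>N\<^sub>0(i)\<close>, \<open>N\<^sub>1(i)\<close> and \<open>N(i)\<close>, each with its structure map from \<open>Cyl A\<close>
  and its structure map from \<open>B\<close>, respectively from the coproduct of two copies of \<open>B\<close>.\<close>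

record ('o, 'm) map_cylinders =
  N0 :: 'o
  N0_cyl :: 'm
  N0_base :: 'm
  N1 :: 'o
  N1_cyl :: 'm
  N1_base :: 'm
  NN :: 'o
  NN_cyl :: 'm
  NN_base :: 'm

definition cylinders_on ::
  "('o, 'm, 'r) category_scheme \<Rightarrow> ('o, 'm) cylinders \<Rightarrow> 'm \<Rightarrow> ('o, 'm) map_cylinders \<Rightarrow> bool"
  where
  "cylinders_on M Z i R \<longleftrightarrow>
     is_pushout M (End0 Z (Dom M i)) i (N0 R) (N0_cyl R) (N0_base R) \<and>
     is_pushout M (End1 Z (Dom M i)) i (N1 R) (N1_cyl R) (N1_base R) \<and>
     is_pushout M (Ends M Z (Dom M i)) (dbl_map M Z i) (NN R) (NN_cyl R) (NN_base R)"

definition iota1 ::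
  "('o, 'm, 'r) category_scheme \<Rightarrow> ('o, 'm) cylinders \<Rightarrow> 'm \<Rightarrow> ('o, 'm) map_cylinders \<Rightarrow> 'm" where
  "iota1 M Z i R = copair M (N1_cyl R) (N1_base R) (CylMap Z i) (End1 Z (Cod M i))"

definition iota ::
  "('o, 'm, 'r) category_scheme \<Rightarrow> ('o, 'm) cylinders \<Rightarrow> 'm \<Rightarrow> ('o, 'm) map_cylinders \<Rightarrow> 'm" where
  "iota M Z i R = copair M (NN_cyl R) (NN_base R) (CylMap Z i) (Ends M Z (Cod M i))"


section \<open>The cartesian gap map\<close>

text \<open>The choices made for \<open>\<alpha>\<close>: \<open>F(\<alpha>)\<close> with \<open>c(\<alpha>)\<close> and the acyclic fibration (\<open>FF\<close>, \<open>cc\<close>,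
  \<open>ff\<close>), \<open>M(\<alpha>,\<alpha>)\<close> with \<open>j\<close> and \<open>j'\<close> (\<open>MM\<close>, \<open>jj\<close>, \<open>jj'\<close>), \<open>C(j)\<close> with the acyclic
  cofibration and \<open>f(j)\<close> (\<open>CJ\<close>, \<open>cj\<close>, \<open>fj\<close>), \<open>P(\<alpha>,\<alpha>)\<close> with \<open>k\<close> and \<open>k'\<close> (\<open>PP\<close>, \<open>kk\<close>, \<open>kk'\<close>).\<close>

record ('o, 'm) gap_data =
  FF :: 'o
  cc :: 'm
  ff :: 'm
  MM :: 'o
  jj :: 'm
  jj' :: 'm
  CJ :: 'o
  cj :: 'm
  fj :: 'm
  PP :: 'o
  kk :: 'm
  kk' :: 'm

definition gap_construction ::
  "('o, 'm, 'r) model_cat_scheme \<Rightarrow> 'm \<Rightarrow> ('o, 'm) gap_data \<Rightarrow> bool" where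
  "gap_construction M \<alpha> G \<longleftrightarrow>
     cc G \<in> hom M (Dom M \<alpha>) (FF G) \<inter> Cof M \<and>
     ff G \<in> hom M (FF G) (Cod M \<alpha>) \<inter> Fib M \<inter> Weq M \<and>
     ff G \<cdot>\<^bsub>M\<^esub> cc G = \<alpha> \<and>
     is_pushout M \<alpha> (cc G) (MM G) (jj' G) (jj G) \<and>
     cj G \<in> hom M (FF G) (CJ G) \<inter> Cof M \<inter> Weq M \<and>
     fj G \<in> hom M (CJ G) (MM G) \<inter> Fib M \<and>
     fj G \<cdot>\<^bsub>M\<^esub> cj G = jj G \<and>
     is_pullback M (jj' G) (fj G) (PP G) (kk' G) (kk G)"

definition gap_map :: "('o, 'm, 'r) category_scheme \<Rightarrow> 'm \<Rightarrow> ('o, 'm) gap_data \<Rightarrow> 'm" where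
  "gap_map M \<alpha> G = pair M (kk' G) (kk G) \<alpha> (cj G \<cdot>\<^bsub>M\<^esub> cc G)"


section \<open>Solution sets and extension problems\<close>

definition Sol ::
  "('o, 'm, 'r) category_scheme \<Rightarrow> ('o, 'm) cylinders \<Rightarrow> 'm \<Rightarrow> 'm \<Rightarrow> 'm \<Rightarrow> 'm \<Rightarrow> 'm \<Rightarrow> ('m \<times> 'm) set"
  where
  "Sol M Z i \<theta> f H h =
     {(K, g). K \<in> hom M (Cyl Z (Cod M i)) (Cod M \<theta>) \<and> g \<in> hom M (Cod M i) (Dom M \<theta>) \<and>
        K \<cdot>\<^bsub>M\<^esub> End0 Z (Cod M i) = f \<and> K \<cdot>\<^bsub>M\<^esub> CylMap Z i = H \<and>
        K \<cdot>\<^bsub>M\<^esub> End1 Z (Cod M i) = \<theta> \<cdot>\<^bsub>M\<^esub> g \<and> g \<cdot>\<^bsub>M\<^esub> i = h}"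

definition LL ::
  "('o, 'm, 'r) category_scheme \<Rightarrow> ('o, 'm) gap_data \<Rightarrow> 'm \<Rightarrow> 'm \<Rightarrow> 'm set" where
  "LL M G i h = {hh \<in> hom M (Cod M i) (FF G). hh \<cdot>\<^bsub>M\<^esub> i = cc G \<cdot>\<^bsub>M\<^esub> h}"

definition chi_spec ::
  "('o, 'm, 'r) category_scheme \<Rightarrow> ('o, 'm) cylinders \<Rightarrow> ('o, 'm) gap_data \<Rightarrow> 'm
     \<Rightarrow> ('o, 'm) map_cylinders \<Rightarrow> 'm \<Rightarrow> 'm \<Rightarrow> 'm \<Rightarrow> 'm \<Rightarrow> bool" where
  "chi_spec M Z G i R f H hh w \<longleftrightarrow>
     w \<in> hom M (NN R) (MM G) \<and>
     w \<cdot>\<^bsub>M\<^esub> NN_cyl R = jj' G \<cdot>\<^bsub>M\<^esub> H \<and>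
     w \<cdot>\<^bsub>M\<^esub> (NN_base R \<cdot>\<^bsub>M\<^esub> In0 Z (Cod M i)) = jj' G \<cdot>\<^bsub>M\<^esub> f \<and>
     w \<cdot>\<^bsub>M\<^esub> (NN_base R \<cdot>\<^bsub>M\<^esub> In1 Z (Cod M i)) = jj G \<cdot>\<^bsub>M\<^esub> hh"

definition chi ::
  "('o, 'm, 'r) category_scheme \<Rightarrow> ('o, 'm) cylinders \<Rightarrow> ('o, 'm) gap_data \<Rightarrow> 'm
     \<Rightarrow> ('o, 'm) map_cylinders \<Rightarrow> 'm \<Rightarrow> 'm \<Rightarrow> 'm \<Rightarrow> 'm" where
  "chi M Z G i R f H hh = (THE w. chi_spec M Z G i R f H hh w)"

definition extensions ::
  "('o, 'm, 'r) category_scheme \<Rightarrow> ('o, 'm) cylinders \<Rightarrow> ('o, 'm) gap_data \<Rightarrow> 'm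
     \<Rightarrow> ('o, 'm) map_cylinders \<Rightarrow> 'm \<Rightarrow> 'm \<Rightarrow> 'm \<Rightarrow> 'm set" where
  "extensions M Z G i R f H hh =
     {X \<in> hom M (Cyl Z (Cod M i)) (MM G). X \<cdot>\<^bsub>M\<^esub> iota M Z i R = chi M Z G i R f H hh}"


section \<open>The maps attached to a lift\<close>

text \<open>The maps \<open>\<lambda>\<^sub>0\<close> and, for a given \<open>\<lambda>\<^sub>0 = l\<close>, the maps \<open>\<nu>\<close> among which a choice is made.\<close>

definition lambda_set ::
  "('o, 'm, 'r) category_scheme \<Rightarrow> ('o, 'm) cylinders \<Rightarrow> ('o, 'm) gap_data \<Rightarrow> 'm \<Rightarrow> 'm \<Rightarrow> 'm
     \<Rightarrow> 'm set" where
  "lambda_set M Z G i H h =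
     {l \<in> hom M (Cyl Z (Dom M i)) (CJ G).
        l \<cdot>\<^bsub>M\<^esub> End1 Z (Dom M i) = cj G \<cdot>\<^bsub>M\<^esub> (cc G \<cdot>\<^bsub>M\<^esub> h) \<and> fj G \<cdot>\<^bsub>M\<^esub> l = jj' G \<cdot>\<^bsub>M\<^esub> H}"

definition mu ::
  "('o, 'm, 'r) category_scheme \<Rightarrow> ('o, 'm) gap_data \<Rightarrow> ('o, 'm) map_cylinders \<Rightarrow> 'm \<Rightarrow> 'm \<Rightarrow> 'm"
  where
  "mu M G R hh l = copair M (N1_cyl R) (N1_base R) l (cj G \<cdot>\<^bsub>M\<^esub> hh)"

definition nu_set ::
  "('o, 'm, 'r) category_scheme \<Rightarrow> ('o, 'm) cylinders \<Rightarrow> ('o, 'm) gap_data \<Rightarrow> 'm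
     \<Rightarrow> ('o, 'm) map_cylinders \<Rightarrow> 'm \<Rightarrow> 'm \<Rightarrow> 'm \<Rightarrow> 'm set" where
  "nu_set M Z G i R hh X l =
     {n \<in> hom M (Cyl Z (Cod M i)) (CJ G).
        n \<cdot>\<^bsub>M\<^esub> iota1 M Z i R = mu M G R hh l \<and> fj G \<cdot>\<^bsub>M\<^esub> n = X}"

text \<open>A choice of \<open>\<lambda>\<^sub>0\<close> and \<open>\<nu>\<close> for every \<open>hh\<close> in \<open>L\<close> and every extension \<open>X\<close> of its \<open>\<chi>\<close>. Nothing
  is assumed about the existence of candidates; it has to come from lifting properties.\<close>

definition lift_choice ::
  "('o, 'm, 'r) category_scheme \<Rightarrow> ('o, 'm) cylinders \<Rightarrow> ('o, 'm) gap_data \<Rightarrow> 'm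
     \<Rightarrow> ('o, 'm) map_cylinders \<Rightarrow> 'm \<Rightarrow> 'm \<Rightarrow> 'm \<Rightarrow> ('m \<Rightarrow> 'm \<Rightarrow> 'm) \<Rightarrow> ('m \<Rightarrow> 'm \<Rightarrow> 'm) \<Rightarrow> bool"
  where
  "lift_choice M Z G i R f H h lam nu \<longleftrightarrow>
     (\<forall>hh \<in> LL M G i h. \<forall>X \<in> extensions M Z G i R f H hh.
        (lambda_set M Z G i H h \<noteq> {} \<longrightarrow> lam hh X \<in> lambda_set M Z G i H h) \<and>
        (nu_set M Z G i R hh X (lam hh X) \<noteq> {} \<longrightarrow>
           nu hh X \<in> nu_set M Z G i R hh X (lam hh X)))"

definition ell ::
  "('o, 'm, 'r) category_scheme \<Rightarrow> ('o, 'm) cylinders \<Rightarrow> 'm \<Rightarrow> ('o, 'm) map_cylinders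
     \<Rightarrow> 'm \<Rightarrow> 'm \<Rightarrow> 'm" where
  "ell M Z i R l n = copair M (N0_cyl R) (N0_base R) l (n \<cdot>\<^bsub>M\<^esub> End0 Z (Cod M i))"

text \<open>The maps into the pullback given by \<open>f\<close>, respectively \<open>H\<close>, and the restriction of a map
  \<open>e\<close> on \<open>N\<^sub>0(i)\<close> to \<open>B\<close>, respectively to \<open>Cyl A\<close>. For \<open>e = ell M Z i R l n\<close> these restrictions
  are \<open>n \<cdot> i\<^sub>0\<close> and \<open>l\<close>.\<close>

definition Phi ::
  "('o, 'm, 'r) category_scheme \<Rightarrow> ('o, 'm) gap_data \<Rightarrow> ('o, 'm) map_cylinders \<Rightarrow> 'm \<Rightarrow> 'm \<Rightarrow> 'm"
  where
  "Phi M G R f e = pair M (kk' G) (kk G) f (e \<cdot>\<^bsub>M\<^esub> N0_base R)"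

definition Psi ::
  "('o, 'm, 'r) category_scheme \<Rightarrow> ('o, 'm) gap_data \<Rightarrow> ('o, 'm) map_cylinders \<Rightarrow> 'm \<Rightarrow> 'm \<Rightarrow> 'm"
  where
  "Psi M G R H e = pair M (kk' G) (kk G) H (e \<cdot>\<^bsub>M\<^esub> N0_cyl R)"

end

theory Submission
  imports Defs
begin

text \<open>A solution \<open>(K, g)\<close> over \<open>\<alpha>\<close> yields \<open>c(\<alpha>) g\<close> in \<open>L\<close> together with the extension \<open>j' K\<close>
  of its \<open>\<chi>\<close>. Conversely, the chosen lifts make \<open>\<Phi>\<close> and \<open>\<Psi>\<close> maps into the pullback
  \<open>P(\<alpha>,\<alpha>)\<close> lying over \<open>f\<close> and \<open>H\<close>, and the cartesian gap map lies over \<open>\<alpha>\<close>; so composing with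
  the projection \<open>k'\<close> turns a solution over the gap map into one over \<open>\<alpha>\<close>.\<close>

section \<open>Universal properties of coproducts, pushouts and pullbacks\<close>

context category
begin

lemma homD:
  assumes "f \<in> hom C A B"
  shows "f \<in> Arr C" "Dom C f = A" "Cod C f = B" "A \<in> Obj C" "B \<in> Obj C"
  using assms dom_closed cod_closed by (auto simp: hom_def)

lemma coproduct_ext:
  assumes "is_coproduct C A B Q p q" "w \<in> hom C Q V" "w' \<in> hom C Q V"
    and "w \<cdot> p = w' \<cdot> p" "w \<cdot> q = w' \<cdot> q"
  shows "w = w'"
proof -
  have "p \<in> hom C A Q" "q \<in> hom C B Q"
    using assms(1) by (simp_all add: is_coproduct_def)
  then have "w \<cdot> p \<in> hom C A V" "w \<cdot> q \<in> hom C B V"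
    using assms(2) comp_closed by blast+
  then have "\<exists>!x. x \<in> hom C Q V \<and> x \<cdot> p = w \<cdot> p \<and> x \<cdot> q = w \<cdot> q"
    using assms(1) unfolding is_coproduct_def by blast
  then show ?thesis using assms(2-5) by metis
qed

lemma coproduct_copair:
  assumes "is_coproduct C A B Q p q" "u \<in> hom C A V" "v \<in> hom C B V"
  shows "copair C p q u v \<in> hom C Q V" "copair C p q u v \<cdot> p = u" "copair C p q u v \<cdot> q = v"
proof -
  \<comment> \<open>\<open>copair\<close> reads its source and target off \<open>Cod C p\<close> and
    \<open>Cod C u\<close>; once these are identified with \<open>Q\<close> and \<open>V\<close>,
    its \<open>THE\<close> ranges over exactly the maps of the universal property.\<close>
  have cod: "Cod C p = Q" "Cod C u = V"
    using assms homD(3) by (auto simp: is_coproduct_def)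
  have "\<exists>!w. w \<in> hom C Q V \<and> w \<cdot> p = u \<and> w \<cdot> q = v"
    using assms by (auto simp: is_coproduct_def)
  from theI'[OF this]
  show "copair C p q u v \<in> hom C Q V" "copair C p q u v \<cdot> p = u" "copair C p q u v \<cdot> q = v"
    unfolding copair_def cod by blast+
qed

lemma pushout_ext:
  assumes "is_pushout C f g Q p q" "w \<in> hom C Q V" "w' \<in> hom C Q V"
    and "w \<cdot> p = w' \<cdot> p" "w \<cdot> q = w' \<cdot> q"
  shows "w = w'"
proof -
  have f: "f \<in> hom C (Dom C f) (Cod C f)" and g: "g \<in> hom C (Dom C f) (Cod C g)"
    and p: "p \<in> hom C (Cod C f) Q" and q: "q \<in> hom C (Cod C g) Q" and sq: "p \<cdot> f = q \<cdot> g"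
    using assms(1) by (auto simp: is_pushout_def hom_def)
  have "w \<cdot> p \<in> hom C (Cod C f) V" "w \<cdot> q \<in> hom C (Cod C g) V"
    using p q assms(2) comp_closed by blast+
  \<comment> \<open>The legs of \<open>w\<close> itself form a compatible cocone, so uniqueness for
    this cocone forces \<open>w'\<close> to equal \<open>w\<close>.\<close>
  moreover have "(w \<cdot> p) \<cdot> f = (w \<cdot> q) \<cdot> g"
    using comp_assoc[OF f p assms(2)] comp_assoc[OF g q assms(2)] sq by simp
  ultimately have "\<exists>!x. x \<in> hom C Q V \<and> x \<cdot> p = w \<cdot> p \<and> x \<cdot> q = w \<cdot> q"
    using assms(1) unfolding is_pushout_def by blast
  then show ?thesis using assms(2-5) by metis
qed

lemma pushout_copair:
  assumes "is_pushout C f g Q p q" "u \<in> hom C (Cod C f) V" "v \<in> hom C (Cod C g) V"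
    and "u \<cdot> f = v \<cdot> g"
  shows "copair C p q u v \<in> hom C Q V" "copair C p q u v \<cdot> p = u" "copair C p q u v \<cdot> q = v"
proof -
  have cod: "Cod C p = Q" "Cod C u = V"
    using assms(1,2) homD(3) by (auto simp: is_pushout_def)
  have "\<exists>!w. w \<in> hom C Q V \<and> w \<cdot> p = u \<and> w \<cdot> q = v"
    using assms by (auto simp: is_pushout_def)
  from theI'[OF this]
  show "copair C p q u v \<in> hom C Q V" "copair C p q u v \<cdot> p = u" "copair C p q u v \<cdot> q = v"
    unfolding copair_def cod by blast+
qed

lemma pullback_pair:
  assumes "is_pullback C f g Q p q" "u \<in> hom C V (Dom C f)" "v \<in> hom C V (Dom C g)"
    and "f \<cdot> u = g \<cdot> v"
  shows "pair C p q u v \<in> hom C V Q" "p \<cdot> pair C p q u v = u" "q \<cdot> pair C p q u v = v"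
proof -
  have dom: "Dom C p = Q" "Dom C u = V"
    using assms(1,2) homD(2) by (auto simp: is_pullback_def)
  have "\<exists>!w. w \<in> hom C V Q \<and> p \<cdot> w = u \<and> q \<cdot> w = v"
    using assms by (auto simp: is_pullback_def)
  from theI'[OF this]
  show "pair C p q u v \<in> hom C V Q" "p \<cdot> pair C p q u v = u" "q \<cdot> pair C p q u v = v"
    unfolding pair_def dom by blast+
qed

end

section \<open>The standing data, cylinders and the pushouts built on \<open>i\<close>\<close>

locale lifting_problem = model_category M
  for M :: "('o, 'm) model_cat" (structure) +
  fixes Z :: "('o, 'm) cylinders"
    and R :: "('o, 'm) map_cylinders"
    and G :: "('o, 'm) gap_data"
    and A B X Y :: 'o
    and i \<alpha> f H h :: 'm
  assumes cylinders: "functorial_good_cylinders M Z"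
    and i: "i \<in> hom M A B"
    and \<alpha>: "\<alpha> \<in> hom M X Y"
    and map_cylinders: "cylinders_on M Z i R"
    and gap: "gap_construction M \<alpha> G"
    and f: "f \<in> hom M B Y"
    and H: "H \<in> hom M (Cyl Z A) Y"
    and h: "h \<in> hom M A X"
    and H_End0: "H \<cdot> End0 Z A = f \<cdot> i"
    and H_End1: "H \<cdot> End1 Z A = \<alpha> \<cdot> h"
begin

lemmas objs = homD(4)[OF i] homD(5)[OF i]

lemma dom_cod [simp]:
  "Dom M i = A" "Cod M i = B" "Dom M \<alpha> = X" "Cod M \<alpha> = Y"
  using homD(2,3) i \<alpha> by blast+

lemma cylinder:
  assumes "D \<in> Obj M"
  shows "is_coproduct M D D (Dbl Z D) (In0 Z D) (In1 Z D)"
    and "In0 Z D \<in> hom M D (Dbl Z D)" and "In1 Z D \<in> hom M D (Dbl Z D)"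
    and "End0 Z D \<in> hom M D (Cyl Z D)" and "End1 Z D \<in> hom M D (Cyl Z D)"
  using cylinders assms by (auto simp: functorial_good_cylinders_def is_coproduct_def)

lemma Ends:
  assumes "D \<in> Obj M"
  shows "Ends M Z D \<in> hom M (Dbl Z D) (Cyl Z D)"
    and "Ends M Z D \<cdot> In0 Z D = End0 Z D" and "Ends M Z D \<cdot> In1 Z D = End1 Z D"
  unfolding Ends_def using coproduct_copair[OF cylinder(1,4,5)] assms by blast+

lemma CylMap:
  "CylMap Z i \<in> hom M (Cyl Z A) (Cyl Z B)"
  "CylMap Z i \<cdot> End0 Z A = End0 Z B \<cdot> i" "CylMap Z i \<cdot> End1 Z A = End1 Z B \<cdot> i"
  using cylinders homD(1)[OF i] dom_cod(1,2)
  by (auto simp: functorial_good_cylinders_def is_functor_def)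

lemma dbl_map:
  "dbl_map M Z i \<in> hom M (Dbl Z A) (Dbl Z B)"
  "dbl_map M Z i \<cdot> In0 Z A = In0 Z B \<cdot> i" "dbl_map M Z i \<cdot> In1 Z A = In1 Z B \<cdot> i"
  unfolding dbl_map_def dom_cod
  using coproduct_copair[OF cylinder(1)[OF objs(1)]
      comp_closed[OF i cylinder(2)[OF objs(2)]] comp_closed[OF i cylinder(3)[OF objs(2)]]] .

text \<open>Maps out of the double of \<open>A\<close> are determined on its two copies, so the
  gluing condition for N(i) may be tested at each end separately. Both \<iota> and \<chi> are
  induced by means of this criterion.\<close>

lemma comp_dbl_map:
  assumes "u \<in> hom M (Cyl Z A) V" "v \<in> hom M (Dbl Z B) V"
    and "u \<cdot> End0 Z A = (v \<cdot> In0 Z B) \<cdot> i" "u \<cdot> End1 Z A = (v \<cdot> In1 Z B) \<cdot> i"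
  shows "u \<cdot> Ends M Z A = v \<cdot> dbl_map M Z i"
proof (rule coproduct_ext[OF cylinder(1)[OF objs(1)]])
  note A = cylinder[OF objs(1)] and B = cylinder[OF objs(2)]
  show "u \<cdot> Ends M Z A \<in> hom M (Dbl Z A) V" "v \<cdot> dbl_map M Z i \<in> hom M (Dbl Z A) V"
    using assms(1,2) Ends(1)[OF objs(1)] dbl_map(1) comp_closed by blast+
  show "(u \<cdot> Ends M Z A) \<cdot> In0 Z A = (v \<cdot> dbl_map M Z i) \<cdot> In0 Z A"
    using comp_assoc[OF A(2) Ends(1)[OF objs(1)] assms(1)] Ends(2)[OF objs(1)] assms(3)
      comp_assoc[OF i B(2) assms(2)] comp_assoc[OF A(2) dbl_map(1) assms(2)] dbl_map(2)
    by simp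
  show "(u \<cdot> Ends M Z A) \<cdot> In1 Z A = (v \<cdot> dbl_map M Z i) \<cdot> In1 Z A"
    using comp_assoc[OF A(3) Ends(1)[OF objs(1)] assms(1)] Ends(3)[OF objs(1)] assms(4)
      comp_assoc[OF i B(3) assms(2)] comp_assoc[OF A(3) dbl_map(1) assms(2)] dbl_map(3)
    by simp
qed

lemma cod_cyl [simp]:
  "Cod M (End0 Z A) = Cyl Z A" "Cod M (End1 Z A) = Cyl Z A"
  "Cod M (Ends M Z A) = Cyl Z A" "Cod M (dbl_map M Z i) = Dbl Z B"
  using homD(3) cylinder(4,5) Ends(1) dbl_map(1) objs by blast+

lemma pushouts:
  "is_pushout M (End0 Z A) i (N0 R) (N0_cyl R) (N0_base R)"
  "is_pushout M (End1 Z A) i (N1 R) (N1_cyl R) (N1_base R)"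
  "is_pushout M (Ends M Z A) (dbl_map M Z i) (NN R) (NN_cyl R) (NN_base R)"
  using map_cylinders by (auto simp: cylinders_on_def)

lemma pushout_maps:
  "N1_cyl R \<in> hom M (Cyl Z A) (N1 R)" "N1_base R \<in> hom M B (N1 R)"
  "NN_cyl R \<in> hom M (Cyl Z A) (NN R)" "NN_base R \<in> hom M (Dbl Z B) (NN R)"
  using pushouts by (auto simp: is_pushout_def)

lemma iota1:
  "iota1 M Z i R \<in> hom M (N1 R) (Cyl Z B)"
  "iota1 M Z i R \<cdot> N1_cyl R = CylMap Z i" "iota1 M Z i R \<cdot> N1_base R = End1 Z B"
  unfolding iota1_def dom_cod
  using pushout_copair[OF pushouts(2), of "CylMap Z i" "Cyl Z B" "End1 Z B"] CylMap
    cylinder(5)[OF objs(2)] by auto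

text \<open>The leg on the double of \<open>B\<close> is split into its two copies, to match the
  form of \<open>chi_spec\<close>. The cocone condition is naturality of the two ends under
  \<open>CylMap\<close>.\<close>

lemma iota:
  "iota M Z i R \<in> hom M (NN R) (Cyl Z B)"
  "iota M Z i R \<cdot> NN_cyl R = CylMap Z i"
  "iota M Z i R \<cdot> (NN_base R \<cdot> In0 Z B) = End0 Z B"
  "iota M Z i R \<cdot> (NN_base R \<cdot> In1 Z B) = End1 Z B"
proof -
  have "CylMap Z i \<cdot> Ends M Z A = Ends M Z B \<cdot> dbl_map M Z i"
    by (rule comp_dbl_map) (use CylMap Ends objs in auto)
  then have *: "iota M Z i R \<in> hom M (NN R) (Cyl Z B)" "iota M Z i R \<cdot> NN_cyl R = CylMap Z i"
    "iota M Z i R \<cdot> NN_base R = Ends M Z B"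
    unfolding iota_def dom_cod
    using pushout_copair[OF pushouts(3), of "CylMap Z i" "Cyl Z B" "Ends M Z B"] CylMap(1)
      Ends(1)[OF objs(2)] by auto
  show "iota M Z i R \<in> hom M (NN R) (Cyl Z B)" "iota M Z i R \<cdot> NN_cyl R = CylMap Z i"
    by fact+
  show "iota M Z i R \<cdot> (NN_base R \<cdot> In0 Z B) = End0 Z B"
    "iota M Z i R \<cdot> (NN_base R \<cdot> In1 Z B) = End1 Z B"
    using comp_assoc[OF cylinder(2)[OF objs(2)] pushout_maps(4) *(1)]
      comp_assoc[OF cylinder(3)[OF objs(2)] pushout_maps(4) *(1)] *(3) Ends(2,3)[OF objs(2)]
    by auto
qed

section \<open>The gap construction on \<alpha>\<close>

lemma gap_maps:
  "cc G \<in> hom M X (FF G)" "jj' G \<in> hom M Y (MM G)" "jj G \<in> hom M (FF G) (MM G)"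
  "cj G \<in> hom M (FF G) (CJ G)" "fj G \<in> hom M (CJ G) (MM G)"
  "kk' G \<in> hom M (PP G) Y"
  "jj' G \<cdot> \<alpha> = jj G \<cdot> cc G" "fj G \<cdot> cj G = jj G"
proof -
  show "cc G \<in> hom M X (FF G)" "cj G \<in> hom M (FF G) (CJ G)" "fj G \<in> hom M (CJ G) (MM G)"
    "fj G \<cdot> cj G = jj G" "jj' G \<cdot> \<alpha> = jj G \<cdot> cc G" and j': "jj' G \<in> hom M Y (MM G)"
    using gap by (auto simp: gap_construction_def is_pushout_def)
  \<comment> \<open>The source and target of \<open>jj G\<close> come from its factorization through
    C(j).\<close>
  then show "jj G \<in> hom M (FF G) (MM G)" using comp_closed by metis
  show "kk' G \<in> hom M (PP G) Y"
    using gap homD(2)[OF j'] by (auto simp: gap_construction_def is_pullback_def)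
qed

text \<open>Common source for the cartesian gap map, \<Phi> and \<Psi>, all of them pairings into
  P(\<alpha>,\<alpha>). The projection \<open>kk' G\<close> to \<open>Y\<close> is the one that
  later carries solutions back to \<alpha>.\<close>

lemma gap_pair:
  assumes "u \<in> hom M V Y" "v \<in> hom M V (CJ G)" "jj' G \<cdot> u = fj G \<cdot> v"
  shows "pair M (kk' G) (kk G) u v \<in> hom M V (PP G)" "kk' G \<cdot> pair M (kk' G) (kk G) u v = u"
proof -
  have "is_pullback M (jj' G) (fj G) (PP G) (kk' G) (kk G)"
    using gap by (simp add: gap_construction_def)
  note P = pullback_pair[OF this, unfolded homD(2)[OF gap_maps(2)] homD(2)[OF gap_maps(5)]]
  show "pair M (kk' G) (kk G) u v \<in> hom M V (PP G)" "kk' G \<cdot> pair M (kk' G) (kk G) u v = u"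
    using P(1,2)[OF assms] by blast+
qed

text \<open>The two components agree in M(\<alpha>,\<alpha>): \<open>fj G\<close> sends
  \<open>cj G \<cdot> cc G\<close> to \<open>jj G \<cdot> cc G\<close>, which is
  \<open>jj' G \<cdot> \<alpha>\<close> by the pushout square.\<close>

lemma gap_map:
  "gap_map M \<alpha> G \<in> hom M X (PP G)" "kk' G \<cdot> gap_map M \<alpha> G = \<alpha>"
  unfolding gap_map_def
  using gap_pair[OF \<alpha> comp_closed[OF gap_maps(1,4)]]
    comp_assoc[OF gap_maps(1,4,5)] gap_maps(7,8) by auto

section \<open>The maps \<chi> and their extensions over Cyl(B)\<close>

lemma LL_iff: "hh \<in> LL M G i h \<longleftrightarrow> hh \<in> hom M B (FF G) \<and> hh \<cdot> i = cc G \<cdot> h"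
  by (simp add: LL_def)

lemma chi_spec_ex1:
  assumes "hh \<in> LL M G i h"
  shows "\<exists>!w. chi_spec M Z G i R f H hh w"
proof -
  have hh: "hh \<in> hom M B (FF G)" "hh \<cdot> i = cc G \<cdot> h" using assms by (auto simp: LL_iff)
  note B = cylinder[OF objs(2)] and A = cylinder[OF objs(1)]
  \<comment> \<open>The N(i) pushout has one leg on the double of \<open>B\<close>, so the two
    prescribed maps on \<open>B\<close> are first merged into one map \<open>b\<close>.\<close>
  define b where "b = copair M (In0 Z B) (In1 Z B) (jj' G \<cdot> f) (jj G \<cdot> hh)"
  have b: "b \<in> hom M (Dbl Z B) (MM G)" "b \<cdot> In0 Z B = jj' G \<cdot> f" "b \<cdot> In1 Z B = jj G \<cdot> hh"
    unfolding b_def using coproduct_copair[OF B(1) comp_closed[OF f gap_maps(2)]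
        comp_closed[OF hh(1) gap_maps(3)]] .
  have u: "jj' G \<cdot> H \<in> hom M (Cyl Z A) (MM G)" using comp_closed[OF H gap_maps(2)] .
  have 0: "(jj' G \<cdot> H) \<cdot> End0 Z A = (b \<cdot> In0 Z B) \<cdot> i"
    using b(2) comp_assoc[OF i f gap_maps(2)] comp_assoc[OF A(4) H gap_maps(2)] H_End0 by simp
  \<comment> \<open>At the end 1, H restricts to \<alpha> h; the pushout square trades
    \<open>jj' G \<cdot> \<alpha>\<close> for \<open>jj G \<cdot> cc G\<close>, and membership in L
    then replaces \<open>cc G \<cdot> h\<close> by \<open>hh \<cdot> i\<close>.\<close>
  have 1: "(jj' G \<cdot> H) \<cdot> End1 Z A = (b \<cdot> In1 Z B) \<cdot> i"
  proof -
    have "(jj' G \<cdot> H) \<cdot> End1 Z A = (jj' G \<cdot> \<alpha>) \<cdot> h"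
      using comp_assoc[OF A(5) H gap_maps(2)] H_End1 comp_assoc[OF h \<alpha> gap_maps(2)] by simp
    also have "\<dots> = jj G \<cdot> (hh \<cdot> i)"
      using gap_maps(7) comp_assoc[OF h gap_maps(1,3)] hh(2) by simp
    finally show ?thesis using b(3) comp_assoc[OF i hh(1) gap_maps(3)] by simp
  qed
  note push = pushout_copair[OF pushouts(3), unfolded cod_cyl,
      OF u b(1) comp_dbl_map[OF u b(1) 0 1]]
  let ?w = "copair M (NN_cyl R) (NN_base R) (jj' G \<cdot> H) b"
  show ?thesis
  proof (rule ex1I[of _ ?w])
    show "chi_spec M Z G i R f H hh ?w"
      using push b(2,3) comp_assoc[OF B(2) pushout_maps(4) push(1)]
        comp_assoc[OF B(3) pushout_maps(4) push(1)]
      by (simp add: chi_spec_def)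
  next
    fix w assume w: "chi_spec M Z G i R f H hh w"
    then have w_hom: "w \<in> hom M (NN R) (MM G)" by (simp add: chi_spec_def)
    \<comment> \<open>Uniqueness also goes in two stages: the coproduct fixes \<open>w\<close> on
      the double of \<open>B\<close>, then the pushout fixes \<open>w\<close>.\<close>
    have "w \<cdot> NN_base R = b"
      using w b comp_assoc[OF B(2) pushout_maps(4) w_hom] comp_assoc[OF B(3) pushout_maps(4) w_hom]
      by (intro coproduct_ext[OF B(1) comp_closed[OF pushout_maps(4) w_hom] b(1)])
        (simp_all add: chi_spec_def)
    then show "w = ?w"
      using w push by (intro pushout_ext[OF pushouts(3) w_hom push(1)]) (simp_all add: chi_spec_def)
  qed
qed

text \<open>\<chi> is determined by its three restrictions, and \<iota> restricts to
  \<open>CylMap Z i\<close>, \<open>End0 Z B\<close> and \<open>End1 Z B\<close>. Hence extending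
  \<chi> amounts to three equations on Cyl(B), and later arguments need not mention N(i).\<close>

lemma extensions_iff:
  assumes "hh \<in> LL M G i h"
  shows "E \<in> extensions M Z G i R f H hh \<longleftrightarrow>
    E \<in> hom M (Cyl Z B) (MM G) \<and> E \<cdot> CylMap Z i = jj' G \<cdot> H \<and>
    E \<cdot> End0 Z B = jj' G \<cdot> f \<and> E \<cdot> End1 Z B = jj G \<cdot> hh"
proof -
  \<comment> \<open>Unique existence makes equality with the \<open>THE\<close> term
    \<open>chi\<close> equivalent to satisfying its specification.\<close>
  have "E \<cdot> iota M Z i R = chi M Z G i R f H hh \<longleftrightarrow> chi_spec M Z G i R f H hh (E \<cdot> iota M Z i R)"
    unfolding chi_def using theI'[OF chi_spec_ex1[OF assms]] the1_equality[OF chi_spec_ex1[OF assms]]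
    by metis
  moreover have "chi_spec M Z G i R f H hh (E \<cdot> iota M Z i R) \<longleftrightarrow>
      E \<cdot> CylMap Z i = jj' G \<cdot> H \<and> E \<cdot> End0 Z B = jj' G \<cdot> f \<and> E \<cdot> End1 Z B = jj G \<cdot> hh"
    if E: "E \<in> hom M (Cyl Z B) (MM G)"
    using comp_assoc[OF pushout_maps(3) iota(1) E] iota
      comp_assoc[OF comp_closed[OF cylinder(2)[OF objs(2)] pushout_maps(4)] iota(1) E]
      comp_assoc[OF comp_closed[OF cylinder(3)[OF objs(2)] pushout_maps(4)] iota(1) E]
      comp_closed[OF iota(1) E]
    by (simp add: chi_spec_def)
  ultimately show ?thesis by (auto simp: extensions_def)
qed

lemma Sol_imp_extension:
  assumes "(K, g) \<in> Sol M Z i \<alpha> f H h"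
  shows "cc G \<cdot> g \<in> LL M G i h" "jj' G \<cdot> K \<in> extensions M Z G i R f H (cc G \<cdot> g)"
proof -
  have K: "K \<in> hom M (Cyl Z B) Y" and g: "g \<in> hom M B X"
    and eqs: "K \<cdot> End0 Z B = f" "K \<cdot> CylMap Z i = H" "K \<cdot> End1 Z B = \<alpha> \<cdot> g" "g \<cdot> i = h"
    using assms by (auto simp: Sol_def)
  show L: "cc G \<cdot> g \<in> LL M G i h"
    using comp_closed[OF g gap_maps(1)] comp_assoc[OF i g gap_maps(1)] eqs(4)
    by (simp add: LL_iff)
  \<comment> \<open>Only the end 1 needs an idea: the pushout square moves
    \<open>jj' G \<cdot> \<alpha>\<close> over to \<open>jj G \<cdot> cc G\<close>.\<close>
  have "(jj' G \<cdot> K) \<cdot> End1 Z B = (jj' G \<cdot> \<alpha>) \<cdot> g"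
    using comp_assoc[OF cylinder(5)[OF objs(2)] K gap_maps(2)] eqs(3)
      comp_assoc[OF g \<alpha> gap_maps(2)] by simp
  also have "\<dots> = jj G \<cdot> (cc G \<cdot> g)" using gap_maps(7) comp_assoc[OF g gap_maps(1,3)] by simp
  finally show "jj' G \<cdot> K \<in> extensions M Z G i R f H (cc G \<cdot> g)"
    using comp_closed[OF K gap_maps(2)] comp_assoc[OF CylMap(1) K gap_maps(2)] eqs
      comp_assoc[OF cylinder(4)[OF objs(2)] K gap_maps(2)]
    by (simp add: extensions_iff[OF L])
qed

section \<open>Lifts against f(j)\<close>

lemma lambda_set_nonempty:
  assumes "left_lifting M (End1 Z A) (fj G)"
  shows "lambda_set M Z G i H h \<noteq> {}"
proof -
  note A = cylinder(5)[OF objs(1)]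
  have u: "cj G \<cdot> (cc G \<cdot> h) \<in> hom M A (CJ G)"
    using comp_closed[OF comp_closed[OF h gap_maps(1)] gap_maps(4)] .
  have v: "jj' G \<cdot> H \<in> hom M (Cyl Z A) (MM G)" using comp_closed[OF H gap_maps(2)] .
  \<comment> \<open>This chain is the commutativity of the lifting square of \<open>End1 Z A\<close>
    against \<open>fj G\<close>, with \<open>cj G \<cdot> (cc G \<cdot> h)\<close> on top and
    \<open>jj' G \<cdot> H\<close> at the bottom; a diagonal is a candidate for \<lambda>.\<close>
  have "fj G \<cdot> (cj G \<cdot> (cc G \<cdot> h)) = jj G \<cdot> (cc G \<cdot> h)"
    using comp_assoc[OF comp_closed[OF h gap_maps(1)] gap_maps(4,5)] gap_maps(8) by simp
  also have "\<dots> = jj' G \<cdot> (\<alpha> \<cdot> h)"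
    using comp_assoc[OF h gap_maps(1,3)] comp_assoc[OF h \<alpha> gap_maps(2)] gap_maps(7) by simp
  also have "\<dots> = (jj' G \<cdot> H) \<cdot> End1 Z A"
    using comp_assoc[OF A H gap_maps(2)] H_End1 by simp
  finally show ?thesis
    using assms u v unfolding left_lifting_def lambda_set_def
    by (simp add: homD(2,3)[OF A] homD(2,3)[OF gap_maps(5)]) blast
qed

lemma lambda_setD:
  assumes "l \<in> lambda_set M Z G i H h"
  shows "l \<in> hom M (Cyl Z A) (CJ G)" "l \<cdot> End1 Z A = cj G \<cdot> (cc G \<cdot> h)" "fj G \<cdot> l = jj' G \<cdot> H"
  using assms by (simp_all add: lambda_set_def)

text \<open>The two pieces agree on \<open>A\<close> because \<open>hh \<cdot> i\<close> is
  \<open>cc G \<cdot> h\<close>, which is the value prescribed for \<open>l\<close> at the end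
  1.\<close>

lemma mu:
  assumes "hh \<in> LL M G i h" "l \<in> lambda_set M Z G i H h"
  shows "mu M G R hh l \<in> hom M (N1 R) (CJ G)" "mu M G R hh l \<cdot> N1_cyl R = l"
    "mu M G R hh l \<cdot> N1_base R = cj G \<cdot> hh"
proof -
  have hh: "hh \<in> hom M B (FF G)" "hh \<cdot> i = cc G \<cdot> h" using assms by (auto simp: LL_iff)
  have "l \<cdot> End1 Z A = (cj G \<cdot> hh) \<cdot> i"
    using comp_assoc[OF i hh(1) gap_maps(4)] lambda_setD(2)[OF assms(2)] hh(2) by simp
  note P = pushout_copair[OF pushouts(2), unfolded cod_cyl dom_cod, OF lambda_setD(1)[OF assms(2)]
      comp_closed[OF hh(1) gap_maps(4)] this]
  show "mu M G R hh l \<in> hom M (N1 R) (CJ G)" "mu M G R hh l \<cdot> N1_cyl R = l"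
    "mu M G R hh l \<cdot> N1_base R = cj G \<cdot> hh"
    unfolding mu_def using P by blast+
qed

text \<open>A diagonal in the square from \<open>iota1\<close> to \<open>fj G\<close>, with \<mu> on
  top and \<open>E\<close> at the bottom. The square commutes because both composites are
  \<open>jj' G \<cdot> H\<close> on Cyl(A) and \<open>jj G \<cdot> hh\<close> on
  \<open>B\<close>.\<close>

lemma nu_set_nonempty:
  assumes "left_lifting M (iota1 M Z i R) (fj G)"
    and hh: "hh \<in> LL M G i h" and E: "E \<in> extensions M Z G i R f H hh"
    and l: "l \<in> lambda_set M Z G i H h"
  shows "nu_set M Z G i R hh E l \<noteq> {}"
proof -
  note m = mu[OF hh l]
  have hh_hom: "hh \<in> hom M B (FF G)" using hh by (simp add: LL_iff)
  have E_hom: "E \<in> hom M (Cyl Z B) (MM G)" and E_eqs: "E \<cdot> CylMap Z i = jj' G \<cdot> H"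
    "E \<cdot> End1 Z B = jj G \<cdot> hh"
    using E by (auto simp: extensions_iff[OF hh])
  have "fj G \<cdot> mu M G R hh l = E \<cdot> iota1 M Z i R"
  proof (rule pushout_ext[OF pushouts(2) comp_closed[OF m(1) gap_maps(5)]
        comp_closed[OF iota1(1) E_hom]])
    show "(fj G \<cdot> mu M G R hh l) \<cdot> N1_cyl R = (E \<cdot> iota1 M Z i R) \<cdot> N1_cyl R"
      using comp_assoc[OF pushout_maps(1) m(1) gap_maps(5)]
        comp_assoc[OF pushout_maps(1) iota1(1) E_hom] m(2) iota1(2) E_eqs(1) lambda_setD(3)[OF l]
      by simp
    show "(fj G \<cdot> mu M G R hh l) \<cdot> N1_base R = (E \<cdot> iota1 M Z i R) \<cdot> N1_base R"
      using comp_assoc[OF pushout_maps(2) m(1) gap_maps(5)]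
        comp_assoc[OF pushout_maps(2) iota1(1) E_hom] m(3) iota1(3) E_eqs(2)
        comp_assoc[OF hh_hom gap_maps(4,5)] gap_maps(8)
      by simp
  qed
  then show ?thesis
    using assms(1) m(1) E_hom unfolding left_lifting_def nu_set_def
    by (simp add: homD(2,3)[OF iota1(1)] homD(2,3)[OF gap_maps(5)]) blast
qed

section \<open>Returning from P(\<alpha>,\<alpha>) to \<open>Y\<close>\<close>

lemma Phi_Psi:
  assumes hh: "hh \<in> LL M G i h" and E: "E \<in> extensions M Z G i R f H hh"
    and l: "l \<in> lambda_set M Z G i H h" and n: "n \<in> nu_set M Z G i R hh E l"
  shows "kk' G \<cdot> Phi M G R f (ell M Z i R l n) = f" "kk' G \<cdot> Psi M G R H (ell M Z i R l n) = H"
proof -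
  note A = cylinder(4)[OF objs(1)] and B = cylinder(4)[OF objs(2)]
  have n_hom: "n \<in> hom M (Cyl Z B) (CJ G)" and n_eqs: "n \<cdot> iota1 M Z i R = mu M G R hh l"
    "fj G \<cdot> n = E"
    using n by (auto simp: nu_set_def)
  \<comment> \<open>Since \<open>n\<close> extends \<mu>, it restricts to \<open>l\<close> on
    Cyl(A). At the end 0 this gives exactly the compatibility that makes \<open>ell\<close> a map on
    N_0(i), so its restrictions are \<open>l\<close> and \<open>n \<cdot> End0 Z B\<close>.\<close>
  have n_cyl: "n \<cdot> CylMap Z i = l"
    using comp_assoc[OF pushout_maps(1) iota1(1) n_hom] n_eqs(1) iota1(2) mu(2)[OF hh l] by simp
  have "l \<cdot> End0 Z A = (n \<cdot> End0 Z B) \<cdot> i"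
    using comp_assoc[OF A CylMap(1) n_hom] n_cyl CylMap(2) comp_assoc[OF i B n_hom] by simp
  note e = pushout_copair[OF pushouts(1), unfolded cod_cyl dom_cod, OF lambda_setD(1)[OF l]
      comp_closed[OF B n_hom] this]
  \<comment> \<open>As \<open>n\<close> lies over \<open>E\<close>, its end 0 lies over
    \<open>jj' G \<cdot> f\<close>; this is the condition for \<Phi> to be a map into the pullback.
    For \<Psi> the condition is already part of \<open>lambda_set\<close>.\<close>
  have "jj' G \<cdot> f = fj G \<cdot> (n \<cdot> End0 Z B)"
    using comp_assoc[OF B n_hom gap_maps(5)] n_eqs(2) E by (simp add: extensions_iff[OF hh])
  then show "kk' G \<cdot> Phi M G R f (ell M Z i R l n) = f"
    using gap_pair(2)[OF f comp_closed[OF B n_hom]] e(3) by (simp add: Phi_def ell_def)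
  show "kk' G \<cdot> Psi M G R H (ell M Z i R l n) = H"
    using gap_pair(2)[OF H lambda_setD(1)[OF l]] lambda_setD(3)[OF l] e(2)
    by (simp add: Psi_def ell_def)
qed

text \<open>Postcomposing with \<open>kk' G\<close> changes only the homotopy: \<open>g\<close> is
  kept, since the gap map and \<alpha> share the source \<open>X\<close> and the gap map lies over
  \<alpha>.\<close>

lemma Sol_gap_map_imp_Sol:
  assumes "(K, g) \<in> Sol M Z i (gap_map M \<alpha> G) \<phi> \<psi> h"
    and "kk' G \<cdot> \<phi> = f" "kk' G \<cdot> \<psi> = H"
  shows "(kk' G \<cdot> K, g) \<in> Sol M Z i \<alpha> f H h"
proof -
  have K: "K \<in> hom M (Cyl Z B) (PP G)" and g: "g \<in> hom M B X"
    and eqs: "K \<cdot> End0 Z B = \<phi>" "K \<cdot> CylMap Z i = \<psi>" "K \<cdot> End1 Z B = gap_map M \<alpha> G \<cdot> g" "g \<cdot> i = h"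
    using assms(1) homD(2,3)[OF gap_map(1)] by (auto simp: Sol_def)
  have "(kk' G \<cdot> K) \<cdot> End1 Z B = \<alpha> \<cdot> g"
    using comp_assoc[OF cylinder(5)[OF objs(2)] K gap_maps(6)] eqs(3)
      comp_assoc[OF g gap_map(1) gap_maps(6)] gap_map(2) by simp
  then show ?thesis
    using comp_closed[OF K gap_maps(6)] g eqs assms(2,3) comp_assoc[OF CylMap(1) K gap_maps(6)]
      comp_assoc[OF cylinder(4)[OF objs(2)] K gap_maps(6)]
    by (simp add: Sol_def)
qed

end

theorem mainTheorem1:
  fixes M :: "('o, 'm) model_cat" (structure)
    and Z :: "('o, 'm) cylinders"
    and R :: "('o, 'm) map_cylinders"
    and G :: "('o, 'm) gap_data"
    and A B X Y :: 'o
    and i \<alpha> f H h :: 'm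
    and lam nu :: "'m \<Rightarrow> 'm \<Rightarrow> 'm"
  assumes "model_category M"
    and "functorial_good_cylinders M Z"
    and "i \<in> hom M A B"
    and "\<alpha> \<in> hom M X Y"
    and "cylinders_on M Z i R"
    and "gap_construction M \<alpha> G"
    and "f \<in> hom M B Y"
    and "H \<in> hom M (Cyl Z A) Y"
    and "h \<in> hom M A X"
    and "H \<cdot> End0 Z A = f \<cdot> i"
    and "H \<cdot> End1 Z A = \<alpha> \<cdot> h"
    and "lift_choice M Z G i R f H h lam nu"
  shows "(\<forall>hh \<in> LL M G i h. \<exists>!w. chi_spec M Z G i R f H hh w)
    \<and> (\<forall>(K, g) \<in> Sol M Z i \<alpha> f H h.
         \<exists>hh \<in> LL M G i h. \<exists>XX. XX \<in> extensions M Z G i R f H hh)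
    \<and> (left_lifting M (End1 Z A) (fj G) \<and> left_lifting M (iota1 M Z i R) (fj G) \<longrightarrow>
         (\<exists>hh \<in> LL M G i h. \<exists>XX \<in> extensions M Z G i R f H hh.
            Sol M Z i (gap_map M \<alpha> G)
              (Phi M G R f (ell M Z i R (lam hh XX) (nu hh XX)))
              (Psi M G R H (ell M Z i R (lam hh XX) (nu hh XX))) h \<noteq> {}) \<longrightarrow>
         Sol M Z i \<alpha> f H h \<noteq> {})"
proof -
  interpret model_category M by fact
  interpret lifting_problem M Z R G A B X Y i \<alpha> f H h
    by unfold_locales (fact assms)+
  have "Sol M Z i \<alpha> f H h \<noteq> {}"
    if lift: "left_lifting M (End1 Z A) (fj G)" "left_lifting M (iota1 M Z i R) (fj G)"
      and hh: "hh \<in> LL M G i h" and XX: "XX \<in> extensions M Z G i R f H hh"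
      and Sol: "Sol M Z i (gap_map M \<alpha> G) (Phi M G R f (ell M Z i R (lam hh XX) (nu hh XX)))
        (Psi M G R H (ell M Z i R (lam hh XX) (nu hh XX))) h \<noteq> {}" for hh XX
  proof -
    \<comment> \<open>\<open>lift_choice\<close> guarantees a member only of a nonempty candidate
      set; nonemptiness comes from the lifting hypotheses. The case of \<open>lam\<close> comes
      first because the candidates for \<open>nu\<close> depend on its value.\<close>
    have l: "lam hh XX \<in> lambda_set M Z G i H h"
      using assms(12) hh XX lambda_set_nonempty[OF lift(1)] unfolding lift_choice_def by blast
    have n: "nu hh XX \<in> nu_set M Z G i R hh XX (lam hh XX)"
      using assms(12) hh XX nu_set_nonempty[OF lift(2) hh XX l] unfolding lift_choice_def by blast
    from Sol Sol_gap_map_imp_Sol[OF _ Phi_Psi[OF hh XX l n]] show ?thesis by fast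
  qed
  then show ?thesis
    using chi_spec_ex1 Sol_imp_extension by blast
qed

end
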